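(* Let $M=(S,s_{init},\mathit{Act},\mathit{Trans})$ be a finite LTS (possibly equipped with a concurrency relation), $B\subseteq\mathit{Act}$, $\rho$ a regular formula and $\alpha_f,\alpha_e\subseteq\mathit{Act}$. For every path predicate $P$ that is feasible and finitely realisable (witnessed by mappings $\phi_{on},\phi_{off},\alpha_{el}$), $M$ satisfies $$\neg\langle\rho\rangle\,\nu X.\Big(\bigwedge_{a\in\overline{B}}\big(\phi_{on}(a)\Rightarrow\langle\overline{\alpha_f}^{\,*}\rangle(\langle\alpha_e\rangle\mathit{tt}\lor(\phi_{off}(a)\land X)\lor\langle\alpha_{el}(a)\setminus\alpha_f\rangle X)\big)\Big)$$ if, and only if, its initial state $s_{init}$ does not admit any path that is $B$-progressing, satisfies $P$, and is $(\rho,\alpha_f,\alpha_e)$-violating.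
   Context: An LTS is $M=(S,s_{init},\mathit{Act},\mathit{Trans})$ with $\mathit{Trans}\subseteq S\times\mathit{Act}\times S$; $S$ and $\mathit{Act}$ finite. A path is an alternating sequence $s_0t_1s_1\dots$ of states and transitions, starting with a state, infinite or ending in a state (its final state), each $t_{i+1}$ going from $s_i$ to $s_{i+1}$. An action occurs on a path if a transition on it carries that label; a path is $\alpha$-free if no action of $\alpha$ occurs on it. An action is enabled in $s$ if a transition with that label leaves $s$. $\overline{\alpha}=\mathit{Act}\setminus\alpha$; $\overline{B}$ is the set of non-blocking actions. A state is $B$-locked if all actions enabled in it are in $B$; a path is $B$-progressing if infinite or its final state is $B$-locked. Regular formulae $R::=\varepsilon\mid\alpha\mid R\cdot Q\mid R+Q\mid R^*$ ($\alpha\subseteq\mathit{Act}$); a finite path matches $R$ if its label sequence is in the language of $R$. A path $\pi$ is $(\rho,\alpha_f,\alpha_e)$-violating if $\pi=\pi_{pre}\cdot\pi_{suf}$ with $\pi_{pre}$ finite matching $\rho$ and $\pi_{suf}$ either $\alpha_f$-free, or containing an action of $\alpha_e$ with the prefix before the first such occurrence $\alpha_f$-free. Modal $\mu$-calculus with standard semantics, $\mathit{tt},\land,\Rightarrow,[a]\phi=\neg\langle a\rangle\neg\phi$, $\nu$ = greatest fixpoint, $\langle\alpha\rangle\phi=\bigvee_{a\in\alpha}\langle a\rangle\phi$, $\langle R\cdot Q\rangle\phi=\langle R\rangle\langle Q\rangle\phi$, $\langle R+Q\rangle\phi=\langle R\rangle\phi\lor\langle Q\rangle\phi$, $\langle R^*\rangle\phi=\mu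 Y.(\langle R\rangle Y\lor\phi)$, $[R]\phi=\neg\langle R\rangle\neg\phi$; an LTS satisfies a closed formula if its initial state does. A path predicate $P$ is finitely realisable if there exist mappings $\phi_{on},\phi_{off}$ from $\overline{B}$ to closed modal $\mu$-calculus formulae and $\alpha_{el}$ from $\overline{B}$ to subsets of $\mathit{Act}$ such that: (1) (invariant) a path $\pi$ satisfies $P$ iff for every state $s$ on $\pi$ and every $a\in\overline{B}$, if $s\in[\![\phi_{on}(a)]\!]$ then the suffix of $\pi$ starting at $s$ contains an occurrence of an action in $\alpha_{el}(a)$ or a state satisfying $\phi_{off}(a)$; (2) (locking) $s$ is $B$-locked iff $s\notin[\![\phi_{on}(a)]\!]$ for all $a\in\overline{B}$; (3) (exclusive) for all $s$ and $a\in\overline{B}$, $s\in[\![\phi_{on}(a)]\!]$ implies $s\notin[\![\phi_{off}(a)]\!]$; (4) (persistent) for all $s$ and $a\in\overline{B}$ with $s\in[\![\phi_{on}(a)]\!]$, if a finite path from $s$ to $s'$ contains no occurrence of an action in $\alpha_{el}(a)$ and no state satisfying $\phi_{off}(a)$, then $s'\in[\![\phi_{on}(a)]\!]$. A path predicate $P$ is feasible if for every LTS, every finite path can be extended to a path of that LTS satisfying $P$. *)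

theory Defs
  imports Main
begin

section \<open>Labelled transition systems\<close>

text \<open>The field \<open>conc\<close> is the optional concurrency relation, so that path predicates
  such as justness may refer to it.  It plays no role in the semantics of formulae.\<close>

record ('s, 'a) lts =
  states :: "'s set"
  initial :: 's
  acts :: "'a set"
  transitions :: "('s \<times> 'a \<times> 's) set"
  conc :: "('a \<times> 'a) set option"

definition enabled :: "('s, 'a) lts \<Rightarrow> 's \<Rightarrow> 'a set" where
  "enabled M s = {a. \<exists>s'. (s, a, s') \<in> transitions M}"

definition locked :: "('s, 'a) lts \<Rightarrow> 'a set \<Rightarrow> 's \<Rightarrow> bool" where
  "locked M B s \<longleftrightarrow> enabled M s \<subseteq> B"


section \<open>Paths\<close>

text \<open>Nonempty, finite or infinite alternating sequences beginning with a state and, if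
  finite, ending in one.  The transition between two consecutive states is the triple
  determined by them and by the label in between: in \<open>Step s a \<pi>\<close> it is
  \<open>(s, a, first \<pi>)\<close>.  The set functions \<open>path_states\<close> and \<open>path_acts\<close> give the
  states on a path and the actions occurring on it.\<close>

codatatype (path_states: 's, path_acts: 'a) path =
    Final (first: 's)
  | Step (first: 's) (label: 'a) (rest: "('s, 'a) path")

coinductive is_path :: "('s, 'a) lts \<Rightarrow> ('s, 'a) path \<Rightarrow> bool" for M where
  "s \<in> states M \<Longrightarrow> is_path M (Final s)"
| "(s, a, first \<pi>) \<in> transitions M \<Longrightarrow> is_path M \<pi> \<Longrightarrow> is_path M (Step s a \<pi>)"

text \<open>\<open>finite_path \<pi> w s\<close>: \<open>\<pi>\<close> is finite with label sequence \<open>w\<close> and final state \<open>s\<close>.\<close>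

inductive finite_path :: "('s, 'a) path \<Rightarrow> 'a list \<Rightarrow> 's \<Rightarrow> bool" where
  "finite_path (Final s) [] s"
| "finite_path \<pi> w s' \<Longrightarrow> finite_path (Step s a \<pi>) (a # w) s'"

text \<open>Concatenation; meaningful if the first argument is finite and its final state is
  the first state of the second one.\<close>

primcorec pconc :: "('s, 'a) path \<Rightarrow> ('s, 'a) path \<Rightarrow> ('s, 'a) path" (infixr "\<cdot>" 65) where
  "\<pi> \<cdot> \<pi>' = (case \<pi> of Final s \<Rightarrow> \<pi>' | Step s a \<pi>\<^sub>1 \<Rightarrow> Step s a (\<pi>\<^sub>1 \<cdot> \<pi>'))"

text \<open>\<open>splits \<pi> w \<pi>\<^sub>1 \<pi>\<^sub>2\<close>: \<open>\<pi> = \<pi>\<^sub>1 \<cdot> \<pi>\<^sub>2\<close> with \<open>\<pi>\<^sub>1\<close> finite with label sequence \<open>w\<close>.\<close>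

definition splits ::
  "('s, 'a) path \<Rightarrow> 'a list \<Rightarrow> ('s, 'a) path \<Rightarrow> ('s, 'a) path \<Rightarrow> bool" where
  "splits \<pi> w \<pi>\<^sub>1 \<pi>\<^sub>2 \<longleftrightarrow> finite_path \<pi>\<^sub>1 w (first \<pi>\<^sub>2) \<and> \<pi> = \<pi>\<^sub>1 \<cdot> \<pi>\<^sub>2"

definition act_free :: "'a set \<Rightarrow> ('s, 'a) path \<Rightarrow> bool" where
  "act_free \<alpha> \<pi> \<longleftrightarrow> path_acts \<pi> \<inter> \<alpha> = {}"

definition progressing :: "('s, 'a) lts \<Rightarrow> 'a set \<Rightarrow> ('s, 'a) path \<Rightarrow> bool" where
  "progressing M B \<pi> \<longleftrightarrow>
     \<not> (\<exists>w s. finite_path \<pi> w s) \<or> (\<exists>w s. finite_path \<pi> w s \<and> locked M B s)"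


section \<open>Well-formed LTSs\<close>

definition concurrency_relation :: "('s, 'a) lts \<Rightarrow> ('a \<times> 'a) set \<Rightarrow> bool" where
  "concurrency_relation M R \<longleftrightarrow>
     R \<subseteq> acts M \<times> acts M \<and> irrefl R \<and>
     (\<forall>a \<pi> w s'. is_path M \<pi> \<and> finite_path \<pi> w s' \<and> a \<in> enabled M (first \<pi>) \<and>
        (\<forall>b \<in> path_acts \<pi>. (a, b) \<in> R) \<longrightarrow> a \<in> enabled M s')"

definition is_lts :: "('s, 'a) lts \<Rightarrow> bool" where
  "is_lts M \<longleftrightarrow>
     finite (states M) \<and> finite (acts M) \<and> initial M \<in> states M \<and>
     transitions M \<subseteq> states M \<times> acts M \<times> states M \<and>
     (case conc M of None \<Rightarrow> True | Some R \<Rightarrow> concurrency_relation M R)"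


section \<open>Regular formulae\<close>

datatype 'a reg =
    Eps
  | Acts "'a set"
  | Seq "'a reg" "'a reg"
  | Alt "'a reg" "'a reg"
  | Star "'a reg"

primrec reg_over :: "'a set \<Rightarrow> 'a reg \<Rightarrow> bool" where
  "reg_over A Eps \<longleftrightarrow> True"
| "reg_over A (Acts \<alpha>) \<longleftrightarrow> \<alpha> \<subseteq> A"
| "reg_over A (Seq R Q) \<longleftrightarrow> reg_over A R \<and> reg_over A Q"
| "reg_over A (Alt R Q) \<longleftrightarrow> reg_over A R \<and> reg_over A Q"
| "reg_over A (Star R) \<longleftrightarrow> reg_over A R"

primrec lang :: "'a reg \<Rightarrow> 'a list set" where
  "lang Eps = {[]}"
| "lang (Acts \<alpha>) = {[a] |a. a \<in> \<alpha>}"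
| "lang (Seq R Q) = {u @ v |u v. u \<in> lang R \<and> v \<in> lang Q}"
| "lang (Alt R Q) = lang R \<union> lang Q"
| "lang (Star R) = {concat us |us. set us \<subseteq> lang R}"

text \<open>In the second disjunct, \<open>pre'\<close> is the part of the suffix before its first occurrence of an
  action of \<open>\<alpha>\<^sub>e\<close>.\<close>

definition violating ::
  "'a reg \<Rightarrow> 'a set \<Rightarrow> 'a set \<Rightarrow> ('s, 'a) path \<Rightarrow> bool" where
  "violating \<rho> \<alpha>\<^sub>f \<alpha>\<^sub>e \<pi> \<longleftrightarrow>
     (\<exists>w pre suf. splits \<pi> w pre suf \<and> w \<in> lang \<rho> \<and>
        (act_free \<alpha>\<^sub>f suf \<or>
         (\<exists>u pre' s a suf'. splits suf u pre' (Step s a suf') \<and>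
            a \<in> \<alpha>\<^sub>e \<and> act_free \<alpha>\<^sub>e pre' \<and> act_free \<alpha>\<^sub>f pre')))"


section \<open>The modal mu-calculus\<close>

datatype 'a form =
    FF
  | Var nat
  | Neg "'a form"
  | Or "'a form" "'a form"
  | Dia 'a "'a form"
  | Mu nat "'a form"
  | Nu nat "'a form"

definition TT :: "'a form" where
  "TT = Neg FF"

definition And :: "'a form \<Rightarrow> 'a form \<Rightarrow> 'a form" where
  "And \<phi> \<psi> = Neg (Or (Neg \<phi>) (Neg \<psi>))"

definition Imp :: "'a form \<Rightarrow> 'a form \<Rightarrow> 'a form" where
  "Imp \<phi> \<psi> = Or (Neg \<phi>) \<psi>"

primrec free_vars :: "'a form \<Rightarrow> nat set" where
  "free_vars FF = {}"
| "free_vars (Var X) = {X}"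
| "free_vars (Neg \<phi>) = free_vars \<phi>"
| "free_vars (Or \<phi> \<psi>) = free_vars \<phi> \<union> free_vars \<psi>"
| "free_vars (Dia a \<phi>) = free_vars \<phi>"
| "free_vars (Mu X \<phi>) = free_vars \<phi> - {X}"
| "free_vars (Nu X \<phi>) = free_vars \<phi> - {X}"

text \<open>\<open>polarity p X \<phi>\<close>: every free occurrence of \<open>X\<close> in \<open>\<phi>\<close> is in the scope of an
  even (\<open>p\<close> true) or odd (\<open>p\<close> false) number of negations.\<close>

primrec polarity :: "bool \<Rightarrow> nat \<Rightarrow> 'a form \<Rightarrow> bool" where
  "polarity p X FF \<longleftrightarrow> True"
| "polarity p X (Var Y) \<longleftrightarrow> (Y = X \<longrightarrow> p)"
| "polarity p X (Neg \<phi>) \<longleftrightarrow> polarity (\<not> p) X \<phi>"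
| "polarity p X (Or \<phi> \<psi>) \<longleftrightarrow> polarity p X \<phi> \<and> polarity p X \<psi>"
| "polarity p X (Dia a \<phi>) \<longleftrightarrow> polarity p X \<phi>"
| "polarity p X (Mu Y \<phi>) \<longleftrightarrow> Y = X \<or> polarity p X \<phi>"
| "polarity p X (Nu Y \<phi>) \<longleftrightarrow> Y = X \<or> polarity p X \<phi>"

text \<open>Formulae over the action set \<open>A\<close> in which fixpoints bind positive variables only.\<close>

primrec wf_form :: "'a set \<Rightarrow> 'a form \<Rightarrow> bool" where
  "wf_form A FF \<longleftrightarrow> True"
| "wf_form A (Var X) \<longleftrightarrow> True"
| "wf_form A (Neg \<phi>) \<longleftrightarrow> wf_form A \<phi>"
| "wf_form A (Or \<phi> \<psi>) \<longleftrightarrow> wf_form A \<phi> \<and> wf_form A \<psi>"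
| "wf_form A (Dia a \<phi>) \<longleftrightarrow> a \<in> A \<and> wf_form A \<phi>"
| "wf_form A (Mu X \<phi>) \<longleftrightarrow> polarity True X \<phi> \<and> wf_form A \<phi>"
| "wf_form A (Nu X \<phi>) \<longleftrightarrow> polarity True X \<phi> \<and> wf_form A \<phi>"

definition closed_form :: "'a set \<Rightarrow> 'a form \<Rightarrow> bool" where
  "closed_form A \<phi> \<longleftrightarrow> wf_form A \<phi> \<and> free_vars \<phi> = {}"

text \<open>The fixpoints are taken in the powerset lattice of \<open>states M\<close>, hence not by \<open>lfp\<close>
  and \<open>gfp\<close>, which range over all sets of the state type.\<close>

primrec sem :: "('s, 'a) lts \<Rightarrow> 'a form \<Rightarrow> (nat \<Rightarrow> 's set) \<Rightarrow> 's set" where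
  "sem M FF e = {}"
| "sem M (Var X) e = e X"
| "sem M (Neg \<phi>) e = states M - sem M \<phi> e"
| "sem M (Or \<phi> \<psi>) e = sem M \<phi> e \<union> sem M \<psi> e"
| "sem M (Dia a \<phi>) e = {s \<in> states M. \<exists>s'. (s, a, s') \<in> transitions M \<and> s' \<in> sem M \<phi> e}"
| "sem M (Mu X \<phi>) e = \<Inter> {T. T \<subseteq> states M \<and> sem M \<phi> (e(X := T)) \<subseteq> T}"
| "sem M (Nu X \<phi>) e = \<Union> {T. T \<subseteq> states M \<and> T \<subseteq> sem M \<phi> (e(X := T))}"

text \<open>For closed formulae the choice of environment is immaterial.\<close>

definition closed_sem :: "('s, 'a) lts \<Rightarrow> 'a form \<Rightarrow> 's set" where
  "closed_sem M \<phi> = sem M \<phi> (\<lambda>_. {})"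

definition satisfies :: "('s, 'a) lts \<Rightarrow> 'a form \<Rightarrow> bool" where
  "satisfies M \<phi> \<longleftrightarrow> initial M \<in> closed_sem M \<phi>"

text \<open>Finite disjunctions and conjunctions, along an arbitrary enumeration of the finite
  index set.\<close>

definition enumeration :: "'b set \<Rightarrow> 'b list" where
  "enumeration A = (SOME xs. set xs = A \<and> distinct xs)"

definition BigOr :: "'b set \<Rightarrow> ('b \<Rightarrow> 'a form) \<Rightarrow> 'a form" where
  "BigOr A f = foldr (\<lambda>a. Or (f a)) (enumeration A) FF"

definition BigAnd :: "'b set \<Rightarrow> ('b \<Rightarrow> 'a form) \<Rightarrow> 'a form" where
  "BigAnd A f = foldr (\<lambda>a. And (f a)) (enumeration A) TT"

definition fresh :: "'a form \<Rightarrow> nat" where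
  "fresh \<phi> = (LEAST Y. Y \<notin> free_vars \<phi>)"

primrec RegDia :: "'a reg \<Rightarrow> 'a form \<Rightarrow> 'a form" where
  "RegDia Eps \<phi> = \<phi>"
| "RegDia (Acts \<alpha>) \<phi> = BigOr \<alpha> (\<lambda>a. Dia a \<phi>)"
| "RegDia (Seq R Q) \<phi> = RegDia R (RegDia Q \<phi>)"
| "RegDia (Alt R Q) \<phi> = Or (RegDia R \<phi>) (RegDia Q \<phi>)"
| "RegDia (Star R) \<phi> = (let Y = fresh \<phi> in Mu Y (Or (RegDia R (Var Y)) \<phi>))"


section \<open>Path predicates\<close>

text \<open>A path predicate takes the LTS as an argument, since it may depend on
  it; it is only ever applied to paths of that LTS.\<close>

type_synonym ('s, 'a) path_pred = "('s, 'a) lts \<Rightarrow> ('s, 'a) path \<Rightarrow> bool"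

definition feasible :: "('s, 'a) path_pred \<Rightarrow> bool" where
  "feasible P \<longleftrightarrow>
     (\<forall>M. is_lts M \<longrightarrow>
        (\<forall>\<pi> w s. is_path M \<pi> \<and> finite_path \<pi> w s \<longrightarrow>
           (\<exists>\<pi>'. first \<pi>' = s \<and> is_path M (\<pi> \<cdot> \<pi>') \<and> P M (\<pi> \<cdot> \<pi>'))))"

definition invariant_cond ::
  "('s, 'a) lts \<Rightarrow> 'a set \<Rightarrow> ('s, 'a) path_pred \<Rightarrow> ('a \<Rightarrow> 'a form) \<Rightarrow> ('a \<Rightarrow> 'a form) \<Rightarrow>
   ('a \<Rightarrow> 'a set) \<Rightarrow> bool" where
  "invariant_cond M B P on off el \<longleftrightarrow>
     (\<forall>\<pi>. is_path M \<pi> \<longrightarrow>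
        (P M \<pi> \<longleftrightarrow>
         (\<forall>w pre suf. splits \<pi> w pre suf \<longrightarrow>
            (\<forall>a \<in> acts M - B. first suf \<in> closed_sem M (on a) \<longrightarrow>
               path_acts suf \<inter> el a \<noteq> {} \<or>
               path_states suf \<inter> closed_sem M (off a) \<noteq> {}))))"

definition locking_cond ::
  "('s, 'a) lts \<Rightarrow> 'a set \<Rightarrow> ('a \<Rightarrow> 'a form) \<Rightarrow> bool" where
  "locking_cond M B on \<longleftrightarrow>
     (\<forall>s \<in> states M. locked M B s \<longleftrightarrow> (\<forall>a \<in> acts M - B. s \<notin> closed_sem M (on a)))"

definition exclusive_cond ::
  "('s, 'a) lts \<Rightarrow> 'a set \<Rightarrow> ('a \<Rightarrow> 'a form) \<Rightarrow> ('a \<Rightarrow> 'a form) \<Rightarrow> bool" where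
  "exclusive_cond M B on off \<longleftrightarrow>
     (\<forall>s \<in> states M. \<forall>a \<in> acts M - B.
        s \<in> closed_sem M (on a) \<longrightarrow> s \<notin> closed_sem M (off a))"

definition persistent_cond ::
  "('s, 'a) lts \<Rightarrow> 'a set \<Rightarrow> ('a \<Rightarrow> 'a form) \<Rightarrow> ('a \<Rightarrow> 'a form) \<Rightarrow> ('a \<Rightarrow> 'a set) \<Rightarrow> bool"
  where
  "persistent_cond M B on off el \<longleftrightarrow>
     (\<forall>s \<in> states M. \<forall>a \<in> acts M - B. s \<in> closed_sem M (on a) \<longrightarrow>
        (\<forall>\<pi> w s'. is_path M \<pi> \<and> first \<pi> = s \<and> finite_path \<pi> w s' \<and>
           path_acts \<pi> \<inter> el a = {} \<and> path_states \<pi> \<inter> closed_sem M (off a) = {} \<longrightarrow>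
           s' \<in> closed_sem M (on a)))"

text \<open>\<open>P\<close> is finitely realisable on \<open>M\<close> iff such \<open>on\<close>, \<open>off\<close>, \<open>el\<close> exist; only their
  values on the non-blocking actions matter.\<close>

definition finitely_realised_by ::
  "('s, 'a) lts \<Rightarrow> 'a set \<Rightarrow> ('s, 'a) path_pred \<Rightarrow> ('a \<Rightarrow> 'a form) \<Rightarrow> ('a \<Rightarrow> 'a form) \<Rightarrow>
   ('a \<Rightarrow> 'a set) \<Rightarrow> bool" where
  "finitely_realised_by M B P on off el \<longleftrightarrow>
     (\<forall>a \<in> acts M - B. closed_form (acts M) (on a) \<and> closed_form (acts M) (off a) \<and>
        el a \<subseteq> acts M) \<and>
     invariant_cond M B P on off el \<and> locking_cond M B on \<and>
     exclusive_cond M B on off \<and> persistent_cond M B on off el"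

end

theory Submission
  imports Defs
begin

text \<open>Let \<open>G\<close> be the greatest fixpoint.  A path from \<open>s\<close> that satisfies \<open>P\<close> and has a
  violating suffix shows that \<open>s\<close> lies in a post-fixpoint, hence in \<open>G\<close>, because \<open>P\<close> is closed
  under suffixes.  Conversely, let \<open>s \<in> G\<close>.  If some state with an outgoing \<open>\<alpha>\<^sub>e\<close>-transition can
  be reached without \<open>\<alpha>\<^sub>f\<close>, feasibility completes that finite path to one satisfying \<open>P\<close>.
  Otherwise every triggered obligation can be discharged by an \<open>\<alpha>\<^sub>f\<close>-free finite path leading
  back to \<open>G\<close>; by persistence, doing this for one non-blocking action after the other yields a
  finite round that discharges all obligations present at its start, and the path obtained by
  concatenating rounds satisfies \<open>P\<close>: an obligation that appears within a round and is not
  discharged there persists until the next one.  Finally, \<open>P\<close> is closed under prepending finite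
  paths by persistence, and implies \<open>B\<close>-progress by locking and exclusiveness.\<close>

section \<open>Finite paths and concatenation\<close>

lemma pconc_simps [simp]:
  "Final s \<cdot> \<pi>' = \<pi>'"
  "Step s a \<pi> \<cdot> \<pi>' = Step s a (\<pi> \<cdot> \<pi>')"
  by (subst pconc.code; simp)+

inductive_simps finite_path_Final [simp]: "finite_path (Final s) w t"
inductive_simps finite_path_Step [simp]: "finite_path (Step s a \<pi>) w t"
inductive_simps is_path_Final [simp]: "is_path M (Final s)"
inductive_simps is_path_Step [simp]: "is_path M (Step s a \<pi>)"

lemma first_pconc:
  "finite_path \<pi> w (first \<pi>') \<Longrightarrow> first (\<pi> \<cdot> \<pi>') = first \<pi>"
  by (cases \<pi>) auto

lemma pconc_assoc:
  "finite_path \<pi> w s \<Longrightarrow> (\<pi> \<cdot> \<pi>') \<cdot> \<pi>'' = \<pi> \<cdot> (\<pi>' \<cdot> \<pi>'')"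
  by (induction rule: finite_path.induct) auto

lemma path_acts_pconc:
  "finite_path \<pi> w s \<Longrightarrow> path_acts (\<pi> \<cdot> \<pi>') = path_acts \<pi> \<union> path_acts \<pi>'"
  by (induction rule: finite_path.induct) auto

lemma first_in_path_states [simp]: "first \<pi> \<in> path_states \<pi>"
  by (cases \<pi>) auto

lemma path_states_pconc:
  "finite_path \<pi> w s \<Longrightarrow> s = first \<pi>' \<Longrightarrow>
    path_states (\<pi> \<cdot> \<pi>') = path_states \<pi> \<union> path_states \<pi>'"
  by (induction rule: finite_path.induct) auto

lemma set_word: "finite_path \<pi> w s \<Longrightarrow> set w = path_acts \<pi>"
  by (induction rule: finite_path.induct) auto

lemma finite_path_pconc:
  "finite_path \<pi> w s \<Longrightarrow> finite_path \<pi>' v t \<Longrightarrow> finite_path (\<pi> \<cdot> \<pi>') (w @ v) t"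
  by (induction rule: finite_path.induct) auto

lemma is_path_pconc:
  "finite_path \<pi> w s \<Longrightarrow> s = first \<pi>' \<Longrightarrow> is_path M \<pi> \<Longrightarrow> is_path M \<pi>' \<Longrightarrow> is_path M (\<pi> \<cdot> \<pi>')"
  by (induction rule: finite_path.induct) (auto simp: first_pconc)

lemma is_path_first: "is_lts M \<Longrightarrow> is_path M \<pi> \<Longrightarrow> first \<pi> \<in> states M"
  by (cases \<pi>) (auto simp: is_lts_def)

text \<open>Cutting makes an intermediate state the end of \<open>\<pi>\<close>; that it lies in
  \<open>states M\<close> comes from the path that follows, via \<open>is_lts M\<close>.\<close>

lemma is_path_pconcD:
  "finite_path \<pi> w s \<Longrightarrow> s = first \<pi>' \<Longrightarrow> is_lts M \<Longrightarrow> is_path M (\<pi> \<cdot> \<pi>') \<Longrightarrow>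
    is_path M \<pi> \<and> is_path M \<pi>'"
  by (induction rule: finite_path.induct) (auto simp: first_pconc is_path_first)

lemma is_path_last:
  "finite_path \<pi> w s \<Longrightarrow> is_path M \<pi> \<Longrightarrow> s \<in> states M"
  by (induction rule: finite_path.induct) auto

lemma is_path_word:
  "finite_path \<pi> w s \<Longrightarrow> is_lts M \<Longrightarrow> is_path M \<pi> \<Longrightarrow> set w \<subseteq> acts M"
  by (induction rule: finite_path.induct) (auto simp: is_lts_def)

lemma splits_refl: "splits \<pi> [] (Final (first \<pi>)) \<pi>"
  by (simp add: splits_def)

lemma splits_Step: "splits \<pi> w \<pi>\<^sub>1 \<pi>\<^sub>2 \<Longrightarrow> splits (Step s a \<pi>) (a # w) (Step s a \<pi>\<^sub>1) \<pi>\<^sub>2"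
  by (simp add: splits_def)

lemma splits_trans:
  "splits \<pi> w \<pi>\<^sub>1 \<pi>\<^sub>2 \<Longrightarrow> splits \<pi>\<^sub>2 v \<pi>\<^sub>3 \<pi>\<^sub>4 \<Longrightarrow> splits \<pi> (w @ v) (\<pi>\<^sub>1 \<cdot> \<pi>\<^sub>3) \<pi>\<^sub>4"
  unfolding splits_def by (metis finite_path_pconc first_pconc pconc_assoc)

text \<open>The path may be infinite, but an occurrence lies at finite depth; hence the induction is
  on membership in the set of labels.\<close>

lemma splits_at_act:
  "b \<in> path_acts \<pi> \<Longrightarrow> \<exists>w pre s suf. splits \<pi> w pre (Step s b suf)"
proof (induction rule: path.set_induct(2))
  case (Step1 s a \<pi>)
  show ?case using splits_refl by blast
next
  case (Step2 s a \<pi> b)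
  then show ?case by (metis splits_Step)
qed

lemma splits_at_state:
  "t \<in> path_states \<pi> \<Longrightarrow> \<exists>w pre suf. splits \<pi> w pre suf \<and> first suf = t"
proof (induction rule: path.set_induct(1))
  case (Final s)
  show ?case using splits_refl[of "Final s"] by force
next
  case (Step1 s a \<pi>)
  show ?case using splits_refl[of "Step s a \<pi>"] by force
next
  case (Step2 s a \<pi> t)
  then show ?case by (metis splits_Step)
qed

section \<open>Reachability by a word\<close>

definition reach :: "('s, 'a) lts \<Rightarrow> 'a list \<Rightarrow> 's \<Rightarrow> 's \<Rightarrow> bool" where
  "reach M w s t \<longleftrightarrow> (\<exists>\<pi>. is_path M \<pi> \<and> first \<pi> = s \<and> finite_path \<pi> w t)"

lemma reach_Nil: "reach M [] s t \<longleftrightarrow> s \<in> states M \<and> t = s"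
proof
  assume "reach M [] s t"
  then show "s \<in> states M \<and> t = s"
    unfolding reach_def by (auto elim: finite_path.cases)
next
  assume "s \<in> states M \<and> t = s"
  then show "reach M [] s t"
    unfolding reach_def by (intro exI[of _ "Final s"]) auto
qed

lemma reach_Cons:
  "reach M (a # w) s t \<longleftrightarrow> (\<exists>u. (s, a, u) \<in> transitions M \<and> reach M w u t)"
proof
  assume "reach M (a # w) s t"
  then obtain \<pi> where "is_path M \<pi>" "first \<pi> = s" "finite_path \<pi> (a # w) t"
    unfolding reach_def by auto
  then show "\<exists>u. (s, a, u) \<in> transitions M \<and> reach M w u t"
    unfolding reach_def by (cases \<pi>) auto
next
  assume "\<exists>u. (s, a, u) \<in> transitions M \<and> reach M w u t"
  then obtain \<pi> where "(s, a, first \<pi>) \<in> transitions M" "is_path M \<pi>" "finite_path \<pi> w t"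
    unfolding reach_def by auto
  then show "reach M (a # w) s t"
    unfolding reach_def by (intro exI[of _ "Step s a \<pi>"]) auto
qed

lemma reach_states: "is_lts M \<Longrightarrow> reach M w s t \<Longrightarrow> s \<in> states M \<and> t \<in> states M"
  unfolding reach_def by (auto simp: is_path_first is_path_last)

lemma reach_append:
  assumes "is_lts M"
  shows "reach M (w @ v) s t \<longleftrightarrow> (\<exists>u. reach M w s u \<and> reach M v u t)"
  by (induction w arbitrary: s) (auto simp: reach_Nil reach_Cons dest: reach_states[OF assms])


section \<open>Semantics of derived formulae\<close>

lemma sem_cong:
  "(\<And>X. X \<in> free_vars \<phi> \<Longrightarrow> e X = e' X) \<Longrightarrow> sem M \<phi> e = sem M \<phi> e'"
proof (induction \<phi> arbitrary: e e')
  case (Mu X \<phi>)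
  have "sem M \<phi> (e(X := T)) = sem M \<phi> (e'(X := T))" for T
    by (rule Mu.IH) (use Mu.prems in auto)
  then show ?case by simp
next
  case (Nu X \<phi>)
  have "sem M \<phi> (e(X := T)) = sem M \<phi> (e'(X := T))" for T
    by (rule Nu.IH) (use Nu.prems in auto)
  then show ?case by simp
next
  case (Or \<phi> \<psi>)
  have "sem M \<phi> e = sem M \<phi> e'"
    by (rule Or.IH(1)) (use Or.prems in auto)
  moreover have "sem M \<psi> e = sem M \<psi> e'"
    by (rule Or.IH(2)) (use Or.prems in auto)
  ultimately show ?case by simp
next
  case (Neg \<phi>)
  have "sem M \<phi> e = sem M \<phi> e'"
    by (rule Neg.IH) (use Neg.prems in auto)
  then show ?case by simp
next
  case (Dia a \<phi>)
  have "sem M \<phi> e = sem M \<phi> e'"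
    by (rule Dia.IH) (use Dia.prems in auto)
  then show ?case by simp
qed auto

lemma sem_closed: "free_vars \<phi> = {} \<Longrightarrow> sem M \<phi> e = closed_sem M \<phi>"
  unfolding closed_sem_def by (rule sem_cong) auto

lemma sem_subset:
  "(\<And>X. e X \<subseteq> states M) \<Longrightarrow> sem M \<phi> e \<subseteq> states M"
proof (induction \<phi> arbitrary: e)
  case (Mu X \<phi>)
  \<comment> \<open>\<open>states M\<close> is itself a pre-fixpoint, so the intersection that
    defines \<open>Mu\<close> lies below it and is not taken over an empty family.\<close>
  have "sem M \<phi> (e(X := states M)) \<subseteq> states M"
    by (rule Mu.IH) (use Mu.prems in auto)
  then show ?case unfolding sem.simps by blast
next
  case (Or \<phi> \<psi>)
  then show ?case unfolding sem.simps by blast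
qed auto

lemma finite_free_vars: "finite (free_vars \<phi>)"
  by (induction \<phi>) auto

lemma fresh_notin: "fresh \<phi> \<notin> free_vars \<phi>"
  unfolding fresh_def
  by (rule LeastI_ex) (meson ex_new_if_finite finite_free_vars infinite_UNIV_nat)

lemma set_enumeration: "finite A \<Longrightarrow> set (enumeration A) = A"
  unfolding enumeration_def using someI_ex[OF finite_distinct_list] by blast

lemma sem_TT: "sem M TT e = states M"
  by (simp add: TT_def)

lemma sem_And: "sem M (And \<phi> \<psi>) e = states M \<inter> sem M \<phi> e \<inter> sem M \<psi> e"
  by (auto simp: And_def)

lemma sem_BigOr: "finite A \<Longrightarrow> sem M (BigOr A f) e = (\<Union>a\<in>A. sem M (f a) e)"
proof -
  have "sem M (foldr (\<lambda>a. Or (f a)) xs FF) e = (\<Union>a\<in>set xs. sem M (f a) e)" for xs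
    by (induction xs) auto
  then show "finite A \<Longrightarrow> ?thesis"
    unfolding BigOr_def by (simp add: set_enumeration)
qed

lemma sem_BigAnd:
  "finite A \<Longrightarrow> sem M (BigAnd A f) e = {s \<in> states M. \<forall>a\<in>A. s \<in> sem M (f a) e}"
proof -
  have "sem M (foldr (\<lambda>a. And (f a)) xs TT) e = {s \<in> states M. \<forall>a\<in>set xs. s \<in> sem M (f a) e}"
    for xs
    by (induction xs) (auto simp: sem_TT sem_And)
  then show "finite A \<Longrightarrow> ?thesis"
    unfolding BigAnd_def by (simp add: set_enumeration)
qed

lemma sem_RegDia_Acts:
  assumes "finite \<alpha>" "is_lts M"
  shows "sem M (RegDia (Acts \<alpha>) \<phi>) e =
    {s. \<exists>a\<in>\<alpha>. \<exists>t. (s, a, t) \<in> transitions M \<and> t \<in> sem M \<phi> e}"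
  using assms by (auto simp: sem_BigOr is_lts_def)

text \<open>For \<open>Star\<close>, the states that reach \<open>\<phi>\<close> by a concatenation
  of matching words form a pre-fixpoint of the unfolded body, and induction on the list of factors
  puts them into every other pre-fixpoint.\<close>

lemma sem_RegDia:
  assumes M: "is_lts M" and e: "\<And>X. e X \<subseteq> states M" and R: "reg_over (acts M) R"
  shows "sem M (RegDia R \<phi>) e = {s. \<exists>w\<in>lang R. \<exists>t\<in>sem M \<phi> e. reach M w s t}"
  using e R
proof (induction R arbitrary: \<phi> e)
  case Eps
  then show ?case using sem_subset[of e M \<phi>] by (auto simp: reach_Nil)
next
  case (Acts \<alpha>)
  then have "finite \<alpha>" using M finite_subset by (auto simp: is_lts_def)
  show ?case
    unfolding sem_RegDia_Acts[OF \<open>finite \<alpha>\<close> M]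
    using sem_subset[of e M \<phi>] Acts by (fastforce simp: reach_Nil reach_Cons)
next
  case (Seq R Q)
  then show ?case by (fastforce simp: reach_append[OF M])
next
  case (Alt R Q)
  then show ?case by auto
next
  case (Star R)
  define Y where "Y = fresh \<phi>"
  define W where "W T = {s. \<exists>w\<in>lang R. \<exists>t\<in>T. reach M w s t}" for T
  let ?L = "{s. \<exists>w\<in>lang (Star R). \<exists>t\<in>sem M \<phi> e. reach M w s t}"
  have body: "sem M (Or (RegDia R (Var Y)) \<phi>) (e(Y := T)) = W T \<union> sem M \<phi> e"
    if "T \<subseteq> states M" for T
  proof -
    have "sem M (RegDia R (Var Y)) (e(Y := T)) =
        {s. \<exists>w\<in>lang R. \<exists>t\<in>sem M (Var Y) (e(Y := T)). reach M w s t}"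
      by (rule Star.IH) (use Star.prems that in \<open>simp_all add: fun_upd_def\<close>)
    then have "sem M (RegDia R (Var Y)) (e(Y := T)) = W T" by (simp only: sem.simps fun_upd_same W_def)
    \<comment> \<open>\<open>Y\<close> is fresh for \<open>\<phi>\<close>, so the new binder
      captures nothing.\<close>
    moreover have "sem M \<phi> (e(Y := T)) = sem M \<phi> e"
      by (rule sem_cong) (use fresh_notin[of \<phi>] in \<open>auto simp: Y_def\<close>)
    ultimately show ?thesis by simp
  qed
  have "sem M (RegDia (Star R) \<phi>) e = \<Inter> {T. T \<subseteq> states M \<and> W T \<union> sem M \<phi> e \<subseteq> T}"
  proof -
    \<comment> \<open>\<open>body\<close> is available only below \<open>states M\<close>; keeping
      this conjunct on both sides makes the two families of pre-fixpoints equal.\<close>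
    have "T \<subseteq> states M \<and> sem M (Or (RegDia R (Var Y)) \<phi>) (e(Y := T)) \<subseteq> T \<longleftrightarrow>
        T \<subseteq> states M \<and> W T \<union> sem M \<phi> e \<subseteq> T" for T
      using body[of T] by metis
    then show ?thesis by (simp only: RegDia.simps Let_def Y_def[symmetric] sem.simps(6))
  qed
  also have "\<dots> = ?L"
  proof (intro equalityI Inter_greatest Inter_lower)
    have "?L \<subseteq> states M" using reach_states[OF M] by blast
    moreover have "W ?L \<subseteq> ?L"
    proof
      fix s assume "s \<in> W ?L"
      then obtain w us t u where "w \<in> lang R" "set us \<subseteq> lang R" "t \<in> sem M \<phi> e"
        "reach M w s u" "reach M (concat us) u t"
        by (auto simp: W_def)
      then have "set (w # us) \<subseteq> lang R" "reach M (concat (w # us)) s t"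
        by (auto simp: reach_append[OF M])
      moreover from this(1) have "concat (w # us) \<in> lang (Star R)" unfolding lang.simps by blast
      ultimately show "s \<in> ?L" using \<open>t \<in> sem M \<phi> e\<close> by blast
    qed
    moreover have "sem M \<phi> e \<subseteq> ?L"
    proof
      fix s assume s: "s \<in> sem M \<phi> e"
      then have "reach M (concat []) s s"
        using sem_subset[of e M \<phi>] Star.prems by (auto simp: reach_Nil)
      moreover have "concat [] \<in> lang (Star R)"
        unfolding lang.simps by (intro CollectI exI[of _ "[]"]) simp
      ultimately show "s \<in> ?L" using s by blast
    qed
    ultimately show "?L \<in> {T. T \<subseteq> states M \<and> W T \<union> sem M \<phi> e \<subseteq> T}" by simp
  next
    fix T assume "T \<in> {T. T \<subseteq> states M \<and> W T \<union> sem M \<phi> e \<subseteq> T}"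
    then have T: "W T \<subseteq> T" "sem M \<phi> e \<subseteq> T" by auto
    have "s \<in> T" if "set us \<subseteq> lang R" "t \<in> sem M \<phi> e" "reach M (concat us) s t" for s t us
      using that
    proof (induction us arbitrary: s)
      case Nil
      then show ?case using T by (auto simp: reach_Nil)
    next
      case (Cons u us)
      then obtain s' where "reach M u s s'" "reach M (concat us) s' t"
        by (auto simp: reach_append[OF M])
      then have "s \<in> W T" using Cons by (auto simp: W_def)
      then show ?case using T by auto
    qed
    then show "?L \<subseteq> T" by auto
  qed
  finally show ?case .
qed

lemma lang_Star_Acts: "lang (Star (Acts \<alpha>)) = {w. set w \<subseteq> \<alpha>}"
proof (intro equalityI subsetI)
  fix w assume "w \<in> lang (Star (Acts \<alpha>))"
  then show "w \<in> {w. set w \<subseteq> \<alpha>}" by fastforce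
next
  fix w assume "w \<in> {w. set w \<subseteq> \<alpha>}"
  then have "set (map (\<lambda>a. [a]) w) \<subseteq> lang (Acts \<alpha>)" "w = concat (map (\<lambda>a. [a]) w)"
    by auto
  then show "w \<in> lang (Star (Acts \<alpha>))" unfolding lang.simps by blast
qed


section \<open>Infinite concatenation of rounds\<close>

text \<open>Follows \<open>p\<close>, then the round \<open>nxt s\<close> from the state \<open>s\<close> reached, and so on; a trivial
  round \<open>Final s\<close> ends the path.  It is intended for \<open>first (nxt s) = s\<close>.\<close>

primcorec weave :: "('s \<Rightarrow> ('s, 'a) path) \<Rightarrow> ('s, 'a) path \<Rightarrow> ('s, 'a) path" where
  "weave nxt p = (case p of
     Final s \<Rightarrow> (case nxt s of Final t \<Rightarrow> Final s | Step t a q \<Rightarrow> Step s a (weave nxt q))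
   | Step s a q \<Rightarrow> Step s a (weave nxt q))"

lemma weave_Step: "weave nxt (Step s a q) = Step s a (weave nxt q)"
  by (subst weave.code) simp

text \<open>To stay productive, the corecursion emits the first step of \<open>nxt s\<close> itself;
  it thereby agrees with starting that round. For a trivial round both sides are the same
  term.\<close>

lemma weave_Final: "first (nxt s) = s \<Longrightarrow> weave nxt (Final s) = weave nxt (nxt s)"
  by (cases "nxt s") (simp, simp add: weave.code[of nxt "Final s"] weave_Step)

lemma first_weave [simp]: "first (weave nxt p) = first p"
  by (subst weave.code) (auto split: path.splits)

lemma weave_finite: "finite_path p w t \<Longrightarrow> weave nxt p = p \<cdot> weave nxt (Final t)"
  by (induction rule: finite_path.induct) (auto simp: weave_Step)


section \<open>Finitely realisable predicates\<close>

definition discharges :: "'a set \<Rightarrow> 's set \<Rightarrow> ('s, 'a) path \<Rightarrow> bool" where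
  "discharges E F \<pi> \<longleftrightarrow> path_acts \<pi> \<inter> E \<noteq> {} \<or> path_states \<pi> \<inter> F \<noteq> {}"

lemma discharges_Step: "discharges E F \<pi> \<Longrightarrow> discharges E F (Step s a \<pi>)"
  by (auto simp: discharges_def)

lemma discharges_pconc:
  "finite_path \<pi> w (first \<pi>') \<Longrightarrow>
    discharges E F (\<pi> \<cdot> \<pi>') \<longleftrightarrow> discharges E F \<pi> \<or> discharges E F \<pi>'"
  by (auto simp: discharges_def path_acts_pconc path_states_pconc)

text \<open>The condition that \<open>violating\<close> puts on the suffix, named so that it can be
  combined with \<open>P\<close> in \<open>good\<close>.\<close>

definition tail_violating :: "'a set \<Rightarrow> 'a set \<Rightarrow> ('s, 'a) path \<Rightarrow> bool" where
  "tail_violating \<alpha>\<^sub>f \<alpha>\<^sub>e \<pi> \<longleftrightarrow> act_free \<alpha>\<^sub>f \<pi> \<or>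
     (\<exists>u pre s a suf. splits \<pi> u pre (Step s a suf) \<and>
        a \<in> \<alpha>\<^sub>e \<and> act_free \<alpha>\<^sub>e pre \<and> act_free \<alpha>\<^sub>f pre)"

lemma violating_iff:
  "violating \<rho> \<alpha>\<^sub>f \<alpha>\<^sub>e \<pi> \<longleftrightarrow>
    (\<exists>w pre suf. splits \<pi> w pre suf \<and> w \<in> lang \<rho> \<and> tail_violating \<alpha>\<^sub>f \<alpha>\<^sub>e suf)"
  by (simp add: violating_def tail_violating_def)

text \<open>It suffices to exhibit any occurrence of an action in \<open>\<alpha>\<^sub>e\<close>, not necessarily the first.\<close>

lemma tail_violatingI:
  assumes "finite_path pre u s'" "a \<in> \<alpha>\<^sub>e" "act_free \<alpha>\<^sub>f pre"
  shows "tail_violating \<alpha>\<^sub>f \<alpha>\<^sub>e (pre \<cdot> Step s' a suf)"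
proof -
  have "\<exists>u' pre' s'' b suf'. splits (pre \<cdot> Step s' a suf) u' pre' (Step s'' b suf') \<and>
          b \<in> \<alpha>\<^sub>e \<and> act_free \<alpha>\<^sub>e pre' \<and> act_free \<alpha>\<^sub>f pre'"
    using assms
  proof (induction rule: finite_path.induct)
    case (1 s)
    then show ?case
      using splits_refl[of "Step s a suf"]
      by (intro exI[of _ "[]"] exI[of _ "Final s"] exI[of _ s] exI[of _ a] exI[of _ suf])
        (auto simp: act_free_def)
  next
    case (2 \<pi> w s' r b)
    show ?case
    \<comment> \<open>The induction searches for the first occurrence from the front: a leading
      label in \<open>\<alpha>\<^sub>e\<close> is found with the empty prefix, any other one extends
      the prefix found in the rest.\<close>
    proof (cases "b \<in> \<alpha>\<^sub>e")
      case True
      then show ?thesis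
        using splits_refl[of "Step r b (\<pi> \<cdot> Step s' a suf)"]
        by (intro exI[of _ "[]"] exI[of _ "Final r"] exI[of _ r] exI[of _ b]
            exI[of _ "\<pi> \<cdot> Step s' a suf"]) (auto simp: act_free_def)
    next
      case False
      obtain u' pre' s'' c suf' where
        "splits (\<pi> \<cdot> Step s' a suf) u' pre' (Step s'' c suf')"
        "c \<in> \<alpha>\<^sub>e" "act_free \<alpha>\<^sub>e pre'" "act_free \<alpha>\<^sub>f pre'"
        using 2 by (auto simp: act_free_def)
      then show ?thesis
        using False "2.prems"(2) splits_Step[of "\<pi> \<cdot> Step s' a suf" u' pre' "Step s'' c suf'" r b]
        by (intro exI[of _ "b # u'"] exI[of _ "Step r b pre'"] exI[of _ s''] exI[of _ c]
            exI[of _ suf']) (auto simp: act_free_def)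
    qed
  qed
  then show ?thesis unfolding tail_violating_def by blast
qed

text \<open>Formulae are replaced by the sets of states they denote in one fixed \<open>M\<close>,
  and \<open>P\<close> by its instance at \<open>M\<close>; the argument then concerns paths and
  sets of states only.\<close>

locale realised =
  fixes M :: "('s, 'a) lts" and B :: "'a set" and P :: "('s, 'a) path \<Rightarrow> bool"
    and on off :: "'a \<Rightarrow> 's set" and el :: "'a \<Rightarrow> 'a set"
  assumes lts: "is_lts M"
    and invariant: "is_path M \<pi> \<Longrightarrow>
      P \<pi> \<longleftrightarrow> (\<forall>w pre suf. splits \<pi> w pre suf \<longrightarrow>
        (\<forall>a \<in> acts M - B. first suf \<in> on a \<longrightarrow> discharges (el a) (off a) suf))"
    and locking: "s \<in> states M \<Longrightarrow> locked M B s \<longleftrightarrow> (\<forall>a \<in> acts M - B. s \<notin> on a)"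
    and exclusive: "s \<in> states M \<Longrightarrow> a \<in> acts M - B \<Longrightarrow> s \<in> on a \<Longrightarrow> s \<notin> off a"
    and persistent: "is_path M \<pi> \<Longrightarrow> finite_path \<pi> w t \<Longrightarrow> a \<in> acts M - B \<Longrightarrow> first \<pi> \<in> on a \<Longrightarrow>
      \<not> discharges (el a) (off a) \<pi> \<Longrightarrow> t \<in> on a"
    and feasible: "is_path M \<pi> \<Longrightarrow> finite_path \<pi> w s \<Longrightarrow>
      \<exists>\<pi>'. first \<pi>' = s \<and> is_path M (\<pi> \<cdot> \<pi>') \<and> P (\<pi> \<cdot> \<pi>')"
begin

section \<open>Closure properties of \<open>P\<close>\<close>

lemma P_splitsD:
  "is_path M \<pi> \<Longrightarrow> P \<pi> \<Longrightarrow> splits \<pi> w pre suf \<Longrightarrow> a \<in> acts M - B \<Longrightarrow> first suf \<in> on a \<Longrightarrow>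
    discharges (el a) (off a) suf"
  by (simp add: invariant)

lemma P_dischargesD:
  "is_path M \<pi> \<Longrightarrow> P \<pi> \<Longrightarrow> a \<in> acts M - B \<Longrightarrow> first \<pi> \<in> on a \<Longrightarrow> discharges (el a) (off a) \<pi>"
  by (rule P_splitsD[OF _ _ splits_refl])

text \<open>A suffix of a suffix is a suffix of the whole path, so its obligations are among those
  of \<open>\<pi>\<close>.\<close>

lemma P_suffix:
  assumes "splits \<pi> w pre suf" "is_path M \<pi>" "P \<pi>"
  shows "is_path M suf \<and> P suf"
proof
  show suf: "is_path M suf"
    using is_path_pconcD[of pre w _ suf, OF _ refl lts] assms by (simp add: splits_def)
  show "P suf"
    unfolding invariant[OF suf] using P_splitsD[OF assms(2,3) splits_trans[OF assms(1)]] by blast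
qed

text \<open>Only the obligations at the added state are new. One that the added transition and its
  two end states leave open persists to \<open>first \<pi>\<close>, where \<open>P \<pi>\<close>
  takes care of it.\<close>

lemma P_Step:
  assumes "is_path M (Step s b \<pi>)" "P \<pi>"
  shows "P (Step s b \<pi>)"
  unfolding invariant[OF assms(1)]
proof (intro allI impI ballI)
  fix w pre suf a
  assume sp: "splits (Step s b \<pi>) w pre suf" and a: "a \<in> acts M - B" and on: "first suf \<in> on a"
  have \<pi>: "is_path M \<pi>" "(s, b, first \<pi>) \<in> transitions M" using assms(1) by auto
  show "discharges (el a) (off a) suf"
  proof (cases pre)
    case (Final t)
    then have suf: "suf = Step s b \<pi>" using sp by (simp add: splits_def)
    let ?p = "Step s b (Final (first \<pi>))"
    have "discharges (el a) (off a) ?p \<Longrightarrow> discharges (el a) (off a) suf"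
      using discharges_pconc[of ?p "[b]" \<pi>] suf by simp
    moreover have "first \<pi> \<in> on a" if "\<not> discharges (el a) (off a) ?p"
      using that persistent[of ?p "[b]" "first \<pi>" a] a on \<pi> is_path_first[OF lts] suf by simp
    ultimately show ?thesis
      using P_dischargesD[OF \<pi>(1) assms(2) a] discharges_Step[of "el a" "off a" \<pi> s b]
      unfolding suf by blast
  next
    case (Step t c p)
    then have "\<exists>v. splits \<pi> v p suf" using sp by (auto simp: splits_def)
    then show ?thesis using P_splitsD[OF \<pi>(1) assms(2) _ a on] by blast
  qed
qed

lemma P_pconc:
  "finite_path pre w s \<Longrightarrow> s = first \<pi> \<Longrightarrow> is_path M pre \<Longrightarrow> is_path M \<pi> \<Longrightarrow> P \<pi> \<Longrightarrow> P (pre \<cdot> \<pi>)"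
proof (induction rule: finite_path.induct)
  case (2 p w t s a)
  then have "P (p \<cdot> \<pi>)" "is_path M (Step s a p \<cdot> \<pi>)"
    by (auto simp: first_pconc is_path_pconc)
  then show ?case using P_Step by auto
qed simp

text \<open>At a final state the remaining path is trivial, so only \<open>off\<close> could
  discharge an obligation there; exclusiveness rules that out, hence nothing is on and the state is
  locked.\<close>

lemma P_progressing:
  assumes "is_path M \<pi>" "P \<pi>"
  shows "progressing M B \<pi>"
proof -
  have "locked M B s" if "finite_path \<pi> w s" for w s
  proof -
    have s: "s \<in> states M" using is_path_last assms(1) that by metis
    have "\<pi> = \<pi> \<cdot> Final s"
      using that by (induction rule: finite_path.induct) auto
    then have sp: "splits \<pi> w \<pi> (Final s)" using that by (simp add: splits_def)
    have "s \<notin> on a" if a: "a \<in> acts M - B" for a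
    proof
      assume on: "s \<in> on a"
      then have "discharges (el a) (off a) (Final s)"
        using P_splitsD[OF assms sp a] by simp
      then show False using exclusive[OF s a on] by (auto simp: discharges_def)
    qed
    then show ?thesis using locking[OF s] by blast
  qed
  then show ?thesis by (auto simp: progressing_def)
qed

section \<open>Rounds and their infinite concatenation\<close>

definition segment :: "'s set \<Rightarrow> 'a set \<Rightarrow> ('s, 'a) path \<Rightarrow> bool" where
  "segment H \<alpha> p \<longleftrightarrow> is_path M p \<and> act_free \<alpha> p \<and> (\<exists>w. \<exists>t \<in> H. finite_path p w t)"

text \<open>\<open>H\<close> constrains only the end, so the tail of a segment is a segment again,
  as unfolding \<open>weave\<close> requires.\<close>

lemma segment_Step:
  "segment H \<alpha> (Step s a p) \<longleftrightarrow> (s, a, first p) \<in> transitions M \<and> a \<notin> \<alpha> \<and> segment H \<alpha> p"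
  by (auto simp: segment_def act_free_def)

text \<open>Induction on the set \<open>C\<close> of obligations to be met. If the round for
  \<open>C\<close> leaves \<open>a\<close> open, persistence keeps \<open>a\<close> on at its end,
  which lies in \<open>H\<close>, so the first hypothesis yields a segment to append.\<close>

lemma round_exists:
  assumes H: "\<And>s a. s \<in> H \<Longrightarrow> a \<in> acts M - B \<Longrightarrow> s \<in> on a \<Longrightarrow>
      \<exists>p. first p = s \<and> segment H \<alpha> p \<and> discharges (el a) (off a) p"
    and "H \<subseteq> states M" "finite C" "C \<subseteq> acts M - B" "s \<in> H"
  shows "\<exists>p. first p = s \<and> segment H \<alpha> p \<and> (\<forall>a\<in>C. s \<in> on a \<longrightarrow> discharges (el a) (off a) p)"
  using assms(3,4)
proof (induction rule: finite_induct)
  case empty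
  then show ?case
    using assms(2,5) by (intro exI[of _ "Final s"]) (auto simp: segment_def act_free_def)
next
  case (insert a C)
  then obtain p where p: "first p = s" "segment H \<alpha> p"
    "\<forall>a\<in>C. s \<in> on a \<longrightarrow> discharges (el a) (off a) p"
    by auto
  show ?case
  proof (cases "s \<in> on a \<and> \<not> discharges (el a) (off a) p")
    case False
    then show ?thesis using p by blast
  next
    case True
    obtain w t where t: "t \<in> H" "finite_path p w t" "is_path M p"
      using p(2) by (auto simp: segment_def)
    have "t \<in> on a" using persistent[OF t(3,2)] True p(1) insert.prems by auto
    then obtain q where q: "first q = t" "segment H \<alpha> q" "discharges (el a) (off a) q"
      using H t(1) insert.prems by blast
    have "first (p \<cdot> q) = s" using first_pconc t q p by metis
    moreover have "segment H \<alpha> (p \<cdot> q)"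
    proof -
      obtain v u where u: "u \<in> H" "finite_path q v u" using q(2) by (auto simp: segment_def)
      then have "\<exists>w. \<exists>u\<in>H. finite_path (p \<cdot> q) w u" using finite_path_pconc[OF t(2)] by blast
      then show ?thesis
        using p(2) q(2) is_path_pconc[OF t(2) q(1)[symmetric] t(3)]
        by (auto simp: segment_def act_free_def path_acts_pconc[OF t(2)])
    qed
    moreover have "\<forall>b\<in>insert a C. s \<in> on b \<longrightarrow> discharges (el b) (off b) (p \<cdot> q)"
      using p(3) q(1,3) discharges_pconc[of p w q] t(2) by auto
    ultimately show ?thesis by blast
  qed
qed

text \<open>\<open>p\<close> is an arbitrary segment rather than a round, so that suffixes are
  covered: each suffix of the woven path is again \<open>weave nxt\<close> of a segment, and
  obligations need to be examined only at the start of such paths.\<close>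

lemma weave_rounds:
  assumes nxt: "\<And>s. s \<in> H \<Longrightarrow> first (nxt s) = s \<and> segment H \<alpha> (nxt s) \<and>
      (\<forall>a\<in>acts M - B. s \<in> on a \<longrightarrow> discharges (el a) (off a) (nxt s))"
    and p: "segment H \<alpha> p"
  shows "is_path M (weave nxt p)" "act_free \<alpha> (weave nxt p)" "P (weave nxt p)"
proof -
  \<comment> \<open>One unfolding of \<open>weave\<close>. If \<open>p\<close> is already at its
    end, the transition is the first one of the next round.\<close>
  have step: "(s, b, first \<pi>) \<in> transitions M \<and> b \<notin> \<alpha> \<and> (\<exists>q. segment H \<alpha> q \<and> \<pi> = weave nxt q)"
    if p: "weave nxt p = Step s b \<pi>" "segment H \<alpha> p" for p s b \<pi>
  proof -
    have "\<exists>q. segment H \<alpha> (Step s b q) \<and> \<pi> = weave nxt q"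
    proof (cases p)
      case (Final t)
      then have t: "t \<in> H" using p(2) by (auto simp: segment_def)
      then have eq: "weave nxt (nxt t) = Step s b \<pi>"
        using weave_Final[of nxt t] nxt Final p(1) by simp
      show ?thesis
      proof (cases "nxt t")
        case (Final u)
        then show ?thesis using eq nxt[OF t] by (simp add: weave.code[of nxt "Final u"])
      next
        case (Step u c q)
        then show ?thesis using eq nxt[OF t] by (auto simp: weave_Step)
      qed
    next
      case (Step t c q)
      then show ?thesis using p by (auto simp: weave_Step)
    qed
    then show ?thesis by (auto simp: segment_Step)
  qed
  have path: "is_path M (weave nxt p)" if "segment H \<alpha> p" for p
  proof -
    define \<pi> where "\<pi> = weave nxt p"
    \<comment> \<open>The coinduction invariant: being the weave of some segment.\<close>
    then have "\<exists>p. segment H \<alpha> p \<and> \<pi> = weave nxt p" using that by auto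
    then have "is_path M \<pi>"
    proof (coinduction arbitrary: \<pi>)
      case is_path
      then obtain p where p: "segment H \<alpha> p" "\<pi> = weave nxt p" by auto
      show ?case
      proof (cases \<pi>)
        case (Final t)
        have "first p \<in> states M" using p(1) is_path_first[OF lts] by (auto simp: segment_def)
        then show ?thesis using Final p(2) first_weave[of nxt p] by auto
      next
        case (Step t b \<pi>')
        then show ?thesis using step[of p t b \<pi>'] p by auto
      qed
    qed
    then show ?thesis by (simp add: \<pi>_def)
  qed
  have suffix: "\<exists>q. segment H \<alpha> q \<and> suf = weave nxt q"
    if "splits (weave nxt p) w pre suf" "segment H \<alpha> p" for p w pre suf
  proof -
    have "finite_path pre w (first suf)" "weave nxt p = pre \<cdot> suf"
      using that by (auto simp: splits_def)
    then show ?thesis using that(2)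
    proof (induction pre w "first suf" arbitrary: p rule: finite_path.induct)
      case 1
      then show ?case by auto
    next
      case (2 \<pi> w s a)
      then show ?case using step[of p s a "\<pi> \<cdot> suf"] by auto
    qed
  qed
  \<comment> \<open>Each occurring label heads a suffix, to which \<open>step\<close>
    applies.\<close>
  show "act_free \<alpha> (weave nxt p)"
    unfolding act_free_def using splits_at_act suffix[OF _ p] step by (metis disjoint_iff)
  show M: "is_path M (weave nxt p)" by (rule path[OF p])
  \<comment> \<open>An obligation at the start of \<open>q\<close> is discharged within
    \<open>q\<close> or, by persistence, still on at its end \<open>t\<close>; there the round
    \<open>nxt t\<close> discharges it.\<close>
  have "discharges (el a) (off a) (weave nxt q)"
    if q: "segment H \<alpha> q" "a \<in> acts M - B" "first q \<in> on a" for q a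
  proof -
    obtain w t where t: "t \<in> H" "finite_path q w t" "is_path M q"
      using q(1) by (auto simp: segment_def)
    obtain v u where u: "finite_path (nxt t) v u"
      using nxt[OF t(1)] by (auto simp: segment_def)
    have "weave nxt q = q \<cdot> weave nxt (nxt t)"
      using weave_finite[OF t(2)] weave_Final nxt[OF t(1)] by metis
    moreover have "discharges (el a) (off a) (weave nxt (nxt t))" if "t \<in> on a"
      using weave_finite[OF u, of nxt] discharges_pconc[of "nxt t" v "weave nxt (Final u)"]
        u nxt[OF t(1)] that q(2) by auto
    ultimately show ?thesis
      using discharges_pconc[of q w "weave nxt (nxt t)"] persistent[OF t(3,2) q(2,3)]
        nxt[OF t(1)] t(2) by auto
  qed
  then show "P (weave nxt p)"
    unfolding invariant[OF M] using suffix[OF _ p] by (metis first_weave)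
qed

section \<open>The greatest fixpoint described by paths\<close>

definition target :: "'a set \<Rightarrow> 'a set \<Rightarrow> 's set \<Rightarrow> 'a \<Rightarrow> 's set" where
  "target \<alpha>\<^sub>f \<alpha>\<^sub>e T a =
     {t. \<exists>b\<in>\<alpha>\<^sub>e. \<exists>t'. (t, b, t') \<in> transitions M} \<union> (off a \<inter> T) \<union>
     {t. \<exists>b\<in>el a - \<alpha>\<^sub>f. \<exists>t'. (t, b, t') \<in> transitions M \<and> t' \<in> T}"

definition body :: "'a set \<Rightarrow> 'a set \<Rightarrow> 's set \<Rightarrow> 's set" where
  "body \<alpha>\<^sub>f \<alpha>\<^sub>e T = {s \<in> states M. \<forall>a\<in>acts M - B. s \<in> on a \<longrightarrow>
     (\<exists>w. set w \<subseteq> acts M - \<alpha>\<^sub>f \<and> (\<exists>t\<in>target \<alpha>\<^sub>f \<alpha>\<^sub>e T a. reach M w s t))}"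

text \<open>The intended value of the greatest fixpoint in terms of paths;
  \<open>good_eq_gfp\<close> confirms it.\<close>

definition good :: "'a set \<Rightarrow> 'a set \<Rightarrow> 's set" where
  "good \<alpha>\<^sub>f \<alpha>\<^sub>e = {first \<pi> |\<pi>. is_path M \<pi> \<and> P \<pi> \<and> tail_violating \<alpha>\<^sub>f \<alpha>\<^sub>e \<pi>}"

text \<open>The words required by \<open>body\<close> are read off the path. If it is free of
  \<open>\<alpha>\<^sub>f\<close>, the place where \<open>a\<close> is discharged is a target: all
  suffixes start in \<open>good\<close>, and a discharging label lies outside
  \<open>\<alpha>\<^sub>f\<close>. Otherwise the state before the action of
  \<open>\<alpha>\<^sub>e\<close> is a target for every \<open>a\<close>.\<close>

lemma good_postfix: "good \<alpha>\<^sub>f \<alpha>\<^sub>e \<subseteq> body \<alpha>\<^sub>f \<alpha>\<^sub>e (good \<alpha>\<^sub>f \<alpha>\<^sub>e)"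
proof
  fix s assume "s \<in> good \<alpha>\<^sub>f \<alpha>\<^sub>e"
  then obtain \<pi> where \<pi>: "first \<pi> = s" "is_path M \<pi>" "P \<pi>" "tail_violating \<alpha>\<^sub>f \<alpha>\<^sub>e \<pi>"
    by (auto simp: good_def)
  have reach: "set w \<subseteq> acts M - \<alpha>\<^sub>f \<and> reach M w s (first suf)"
    if "splits \<pi> w pre suf" "act_free \<alpha>\<^sub>f pre" for w pre suf
  proof -
    have pre: "finite_path pre w (first suf)" "\<pi> = pre \<cdot> suf"
      using that(1) by (auto simp: splits_def)
    have "is_path M pre" using is_path_pconcD[OF pre(1) refl lts] \<pi>(2) pre(2) by blast
    moreover have "first pre = s" using first_pconc pre \<pi>(1) by metis
    ultimately show ?thesis
      using pre(1) is_path_word[OF pre(1) lts] set_word[OF pre(1)] that(2)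
      by (auto simp: reach_def act_free_def)
  qed
  have "\<exists>w. set w \<subseteq> acts M - \<alpha>\<^sub>f \<and> (\<exists>t\<in>target \<alpha>\<^sub>f \<alpha>\<^sub>e (good \<alpha>\<^sub>f \<alpha>\<^sub>e) a. reach M w s t)"
    if a: "a \<in> acts M - B" "s \<in> on a" for a
  proof (cases "act_free \<alpha>\<^sub>f \<pi>")
    case True
    have suf: "act_free \<alpha>\<^sub>f pre" "first suf \<in> good \<alpha>\<^sub>f \<alpha>\<^sub>e" "act_free \<alpha>\<^sub>f suf" "is_path M suf" "P suf"
      if "splits \<pi> w pre suf" for w pre suf
    proof -
      show free: "act_free \<alpha>\<^sub>f pre" "act_free \<alpha>\<^sub>f suf"
        using that True path_acts_pconc by (fastforce simp: act_free_def splits_def)+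
      show "is_path M suf" "P suf" using P_suffix[OF that \<pi>(2,3)] by auto
      then show "first suf \<in> good \<alpha>\<^sub>f \<alpha>\<^sub>e" using free by (auto simp: good_def tail_violating_def)
    qed
    have "discharges (el a) (off a) \<pi>" using P_dischargesD[OF \<pi>(2,3) a(1)] a(2) \<pi>(1) by simp
    then consider b where "b \<in> path_acts \<pi>" "b \<in> el a" | t where "t \<in> path_states \<pi>" "t \<in> off a"
      by (auto simp: discharges_def)
    then show ?thesis
    proof cases
      case 1
      then obtain w pre t \<pi>' where sp: "splits \<pi> w pre (Step t b \<pi>')"
        using splits_at_act by metis
      \<comment> \<open>Cutting also after the discharging transition puts the state it leads to
        into \<open>good\<close>.\<close>
      have "splits (Step t b \<pi>') [b] (Step t b (Final (first \<pi>'))) \<pi>'"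
        by (simp add: splits_def)
      then have "first \<pi>' \<in> good \<alpha>\<^sub>f \<alpha>\<^sub>e" using suf(2) splits_trans sp by metis
      then have "t \<in> target \<alpha>\<^sub>f \<alpha>\<^sub>e (good \<alpha>\<^sub>f \<alpha>\<^sub>e) a"
        using suf(3,4)[OF sp] 1 by (auto simp: target_def act_free_def)
      then show ?thesis using reach[OF sp suf(1)[OF sp]] by auto
    next
      case 2
      then obtain w pre suf where sp: "splits \<pi> w pre suf" "first suf = t"
        using splits_at_state by metis
      then have "t \<in> target \<alpha>\<^sub>f \<alpha>\<^sub>e (good \<alpha>\<^sub>f \<alpha>\<^sub>e) a"
        using suf(2)[OF sp(1)] 2 by (auto simp: target_def)
      then show ?thesis using reach[OF sp(1) suf(1)[OF sp(1)]] sp(2) by auto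
    qed
  next
    case False
    then obtain u pre t b suf where sp: "splits \<pi> u pre (Step t b suf)" "b \<in> \<alpha>\<^sub>e" "act_free \<alpha>\<^sub>f pre"
      using \<pi>(4) by (auto simp: tail_violating_def)
    have "is_path M (Step t b suf)" using P_suffix[OF sp(1) \<pi>(2,3)] by simp
    then have "t \<in> target \<alpha>\<^sub>f \<alpha>\<^sub>e (good \<alpha>\<^sub>f \<alpha>\<^sub>e) a" using sp(2) by (auto simp: target_def)
    then show ?thesis using reach[OF sp(1,3)] by auto
  qed
  moreover have "s \<in> states M" using is_path_first[OF lts \<pi>(2)] \<pi>(1) by simp
  ultimately show "s \<in> body \<alpha>\<^sub>f \<alpha>\<^sub>e (good \<alpha>\<^sub>f \<alpha>\<^sub>e)" by (simp add: body_def)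
qed

text \<open>The semantics of \<open>Nu\<close> is the union of post-fixpoints, so any such
  \<open>G\<close> is treated. Feasibility gives no control over the labels it appends, so it serves
  only once an \<open>\<alpha>\<^sub>e\<close>-transition is secured; otherwise the path is woven by
  hand.\<close>

lemma postfix_good:
  assumes G: "G \<subseteq> body \<alpha>\<^sub>f \<alpha>\<^sub>e G"
  shows "G \<subseteq> good \<alpha>\<^sub>f \<alpha>\<^sub>e"
proof
  fix s assume s: "s \<in> G"
  define escape where "escape s \<longleftrightarrow>
    (\<exists>w t b t'. set w \<inter> \<alpha>\<^sub>f = {} \<and> reach M w s t \<and> b \<in> \<alpha>\<^sub>e \<and> (t, b, t') \<in> transitions M)" for s
  \<comment> \<open>On \<open>H\<close> the first disjunct of \<open>target\<close> is excluded, so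
    each witness leads back to \<open>G\<close>.\<close>
  define H where "H = {s \<in> G. \<not> escape s}"
  have H_states: "H \<subseteq> states M" using G by (auto simp: H_def body_def)
  \<comment> \<open>By contraposition, a path free of \<open>\<alpha>\<^sub>f\<close> that starts in
    \<open>H\<close> and returns to \<open>G\<close> ends in \<open>H\<close>.\<close>
  have escape_reach: "escape s" if t: "escape t" "reach M w s t" "set w \<inter> \<alpha>\<^sub>f = {}" for s t w
  proof -
    obtain v u b u' where "set v \<inter> \<alpha>\<^sub>f = {}" "reach M v t u" "b \<in> \<alpha>\<^sub>e" "(u, b, u') \<in> transitions M"
      using t(1) by (auto simp: escape_def)
    moreover from this have "set (w @ v) \<inter> \<alpha>\<^sub>f = {}" "reach M (w @ v) s u"
      using t by (auto simp: reach_append[OF lts])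
    ultimately show ?thesis unfolding escape_def by blast
  qed
  show "s \<in> good \<alpha>\<^sub>f \<alpha>\<^sub>e"
  proof (cases "escape s")
    case True
    then obtain p w t b t' where p: "set w \<inter> \<alpha>\<^sub>f = {}" "is_path M p" "first p = s"
      "finite_path p w t" "b \<in> \<alpha>\<^sub>e" "(t, b, t') \<in> transitions M"
      by (auto simp: escape_def reach_def)
    \<comment> \<open>The prefix given to feasibility includes the
      \<open>\<alpha>\<^sub>e\<close>-transition, so the violation is fixed whatever extension
      results.\<close>
    let ?q = "Step t b (Final t')"
    have "t' \<in> states M" using p(6) lts by (auto simp: is_lts_def)
    then have "is_path M (p \<cdot> ?q)" using p is_path_pconc[OF p(4), of ?q] by simp
    moreover have "finite_path (p \<cdot> ?q) (w @ [b]) t'"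
      using finite_path_pconc[OF p(4), of ?q "[b]"] by simp
    ultimately obtain \<pi>' where \<pi>': "is_path M ((p \<cdot> ?q) \<cdot> \<pi>')" "P ((p \<cdot> ?q) \<cdot> \<pi>')"
      using feasible by blast
    have eq: "(p \<cdot> ?q) \<cdot> \<pi>' = p \<cdot> Step t b \<pi>'" by (simp add: pconc_assoc[OF p(4)])
    have "tail_violating \<alpha>\<^sub>f \<alpha>\<^sub>e (p \<cdot> Step t b \<pi>')"
      by (rule tail_violatingI[OF p(4,5)]) (use p(1) set_word[OF p(4)] in \<open>auto simp: act_free_def\<close>)
    moreover have "first (p \<cdot> Step t b \<pi>') = s" using first_pconc[of p w "Step t b \<pi>'"] p by simp
    ultimately show ?thesis using \<pi>' unfolding eq good_def by blast
  next
    case False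
    have "\<exists>p. first p = s \<and> segment H \<alpha>\<^sub>f p \<and> discharges (el a) (off a) p"
      if s: "s \<in> H" and a: "a \<in> acts M - B" "s \<in> on a" for s a
    proof -
      have "s \<in> body \<alpha>\<^sub>f \<alpha>\<^sub>e G" using s G by (auto simp: H_def)
      then obtain w t where t: "set w \<inter> \<alpha>\<^sub>f = {}" "reach M w s t" "t \<in> target \<alpha>\<^sub>f \<alpha>\<^sub>e G a"
        using a unfolding body_def by blast
      then obtain p where p: "is_path M p" "first p = s" "finite_path p w t"
        by (auto simp: reach_def)
      have free: "act_free \<alpha>\<^sub>f p" using t(1) set_word[OF p(3)] by (auto simp: act_free_def)
      have "\<not> escape s" using s by (simp add: H_def)
      then have "\<not> (\<exists>b\<in>\<alpha>\<^sub>e. \<exists>t'. (t, b, t') \<in> transitions M)"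
        using t(1,2) unfolding escape_def by blast
      then consider "t \<in> off a" "t \<in> G"
        | b t' where "b \<in> el a" "b \<notin> \<alpha>\<^sub>f" "(t, b, t') \<in> transitions M" "t' \<in> G"
        using t(3) by (auto simp: target_def)
      then show ?thesis
      proof cases
        case 1
        have "t \<in> H" using 1 escape_reach[of t w s] t \<open>\<not> escape s\<close> by (auto simp: H_def)
        moreover have "t \<in> path_states p"
          using p(3) by (induction rule: finite_path.induct) auto
        ultimately show ?thesis
          using p free 1 by (auto simp: segment_def discharges_def intro!: exI[of _ p])
      next
        case 2
        \<comment> \<open>The discharging transition is appended, so that the segment itself
          contains the label in \<open>el a\<close>.\<close>
        let ?q = "Step t b (Final t')"
        have t': "t' \<in> states M" using 2 lts by (auto simp: is_lts_def)
        have path: "is_path M (p \<cdot> ?q)" using p is_path_pconc[OF p(3), of ?q] 2 t' by simp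
        have fin: "finite_path (p \<cdot> ?q) (w @ [b]) t'"
          using finite_path_pconc[OF p(3), of ?q "[b]"] by simp
        have first: "first (p \<cdot> ?q) = s" using first_pconc[of p w ?q] p by simp
        have "reach M (w @ [b]) s t'" using path fin first by (auto simp: reach_def)
        then have "t' \<in> H"
          using 2 escape_reach[of t' "w @ [b]" s] t(1) \<open>\<not> escape s\<close> by (auto simp: H_def)
        moreover have "path_acts (p \<cdot> ?q) = insert b (path_acts p)"
          by (simp add: path_acts_pconc[OF p(3)])
        ultimately show ?thesis
          using path fin first free 2
          by (auto simp: segment_def discharges_def act_free_def intro!: exI[of _ "p \<cdot> ?q"])
      qed
    qed
    moreover have "finite (acts M - B)" using lts by (simp add: is_lts_def)
    ultimately have "\<exists>p. first p = s \<and> segment H \<alpha>\<^sub>f p \<and>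
        (\<forall>a\<in>acts M - B. s \<in> on a \<longrightarrow> discharges (el a) (off a) p)" if "s \<in> H" for s
      using round_exists[OF _ H_states _ subset_refl that] by blast
    then obtain nxt where nxt: "\<And>s. s \<in> H \<Longrightarrow> first (nxt s) = s \<and> segment H \<alpha>\<^sub>f (nxt s) \<and>
        (\<forall>a\<in>acts M - B. s \<in> on a \<longrightarrow> discharges (el a) (off a) (nxt s))"
      by metis
    have "s \<in> H" using s False by (simp add: H_def)
    then have "first (nxt s) = s" "segment H \<alpha>\<^sub>f (nxt s)" using nxt by auto
    moreover from this(2) have "is_path M (weave nxt (nxt s))" "act_free \<alpha>\<^sub>f (weave nxt (nxt s))"
      "P (weave nxt (nxt s))"
      using weave_rounds[OF nxt] by blast+
    ultimately show ?thesis
      by (auto simp: good_def tail_violating_def intro!: exI[of _ "weave nxt (nxt s)"])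
  qed
qed

lemma good_eq_gfp: "\<Union> {T. T \<subseteq> states M \<and> T \<subseteq> body \<alpha>\<^sub>f \<alpha>\<^sub>e T} = good \<alpha>\<^sub>f \<alpha>\<^sub>e"
proof -
  have "good \<alpha>\<^sub>f \<alpha>\<^sub>e \<subseteq> states M" using is_path_first[OF lts] by (auto simp: good_def)
  then show ?thesis using good_postfix postfix_good by blast
qed

text \<open>Cutting after the word in \<open>lang \<rho>\<close> keeps \<open>P\<close> by
  \<open>P_suffix\<close>; prepending keeps it by \<open>P_pconc\<close>, and progress then follows
  by \<open>P_progressing\<close>.\<close>

lemma violating_path_iff:
  "(\<exists>\<pi>. is_path M \<pi> \<and> first \<pi> = s \<and> progressing M B \<pi> \<and> P \<pi> \<and> violating \<rho> \<alpha>\<^sub>f \<alpha>\<^sub>e \<pi>) \<longleftrightarrow>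
    (\<exists>w\<in>lang \<rho>. \<exists>t\<in>good \<alpha>\<^sub>f \<alpha>\<^sub>e. reach M w s t)"
proof
  assume "\<exists>\<pi>. is_path M \<pi> \<and> first \<pi> = s \<and> progressing M B \<pi> \<and> P \<pi> \<and> violating \<rho> \<alpha>\<^sub>f \<alpha>\<^sub>e \<pi>"
  then obtain \<pi> w pre suf where \<pi>: "is_path M \<pi>" "first \<pi> = s" "P \<pi>" "splits \<pi> w pre suf"
    "w \<in> lang \<rho>" "tail_violating \<alpha>\<^sub>f \<alpha>\<^sub>e suf"
    by (auto simp: violating_iff)
  then have pre: "finite_path pre w (first suf)" "\<pi> = pre \<cdot> suf" by (auto simp: splits_def)
  have "is_path M pre" using is_path_pconcD[OF pre(1) refl lts] \<pi>(1) pre(2) by blast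
  moreover have "first pre = s" using first_pconc pre \<pi>(2) by metis
  ultimately have "reach M w s (first suf)" using pre(1) by (auto simp: reach_def)
  moreover have "first suf \<in> good \<alpha>\<^sub>f \<alpha>\<^sub>e"
    using P_suffix[OF \<pi>(4,1,3)] \<pi>(6) by (auto simp: good_def)
  ultimately show "\<exists>w\<in>lang \<rho>. \<exists>t\<in>good \<alpha>\<^sub>f \<alpha>\<^sub>e. reach M w s t" using \<pi>(5) by blast
next
  assume "\<exists>w\<in>lang \<rho>. \<exists>t\<in>good \<alpha>\<^sub>f \<alpha>\<^sub>e. reach M w s t"
  then obtain w pre suf where suf: "w \<in> lang \<rho>" "is_path M suf" "P suf" "tail_violating \<alpha>\<^sub>f \<alpha>\<^sub>e suf"
    and pre: "is_path M pre" "first pre = s" "finite_path pre w (first suf)"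
    by (auto simp: good_def reach_def)
  have "is_path M (pre \<cdot> suf)" "P (pre \<cdot> suf)"
    using is_path_pconc[OF pre(3) refl pre(1) suf(2)] P_pconc[OF pre(3) refl pre(1) suf(2,3)]
    by auto
  moreover have "violating \<rho> \<alpha>\<^sub>f \<alpha>\<^sub>e (pre \<cdot> suf)"
    using suf pre(3) by (auto simp: violating_iff splits_def)
  ultimately show "\<exists>\<pi>. is_path M \<pi> \<and> first \<pi> = s \<and> progressing M B \<pi> \<and> P \<pi> \<and>
      violating \<rho> \<alpha>\<^sub>f \<alpha>\<^sub>e \<pi>"
    using P_progressing first_pconc[OF pre(3)] pre(2) by blast
qed

end

section \<open>Transfer to formulae\<close>

lemma realised_closed_sem:
  assumes "is_lts M" "feasible P" "finitely_realised_by M B P on off el"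
  shows "realised M B (P M) (\<lambda>a. closed_sem M (on a)) (\<lambda>a. closed_sem M (off a)) el"
proof
  fix \<pi> assume "is_path M \<pi>"
  then show "P M \<pi> \<longleftrightarrow> (\<forall>w pre suf. splits \<pi> w pre suf \<longrightarrow>
      (\<forall>a \<in> acts M - B. first suf \<in> closed_sem M (on a) \<longrightarrow>
        discharges (el a) (closed_sem M (off a)) suf))"
    using assms(3) unfolding finitely_realised_by_def invariant_cond_def discharges_def by blast
next
  fix \<pi> w t a
  assume "is_path M \<pi>" "finite_path \<pi> w t" "a \<in> acts M - B" "first \<pi> \<in> closed_sem M (on a)"
    "\<not> discharges (el a) (closed_sem M (off a)) \<pi>"
  then show "t \<in> closed_sem M (on a)"
    using assms(3) is_path_first[OF assms(1)]
    unfolding finitely_realised_by_def persistent_cond_def discharges_def by blast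
next
  fix \<pi> w s assume "is_path M \<pi>" "finite_path \<pi> w s"
  then show "\<exists>\<pi>'. first \<pi>' = s \<and> is_path M (\<pi> \<cdot> \<pi>') \<and> P M (\<pi> \<cdot> \<pi>')"
    using assms(1,2) unfolding feasible_def by blast
qed (use assms in \<open>auto simp: finitely_realised_by_def locking_cond_def exclusive_cond_def\<close>)

theorem theorem24:
  fixes M :: "('s, 'a) lts" and P :: "('s, 'a) path_pred"
    and B \<alpha>\<^sub>f \<alpha>\<^sub>e :: "'a set" and \<rho> :: "'a reg"
    and on off :: "'a \<Rightarrow> 'a form" and el :: "'a \<Rightarrow> 'a set" and X :: nat
  assumes "is_lts M"
    and "B \<subseteq> acts M" and "\<alpha>\<^sub>f \<subseteq> acts M" and "\<alpha>\<^sub>e \<subseteq> acts M" and "reg_over (acts M) \<rho>"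
    and "feasible P"
    and "finitely_realised_by M B P on off el"
  shows "satisfies M
      (Neg (RegDia \<rho> (Nu X (BigAnd (acts M - B) (\<lambda>a.
         Imp (on a)
           (RegDia (Star (Acts (acts M - \<alpha>\<^sub>f)))
              (Or (RegDia (Acts \<alpha>\<^sub>e) TT)
                 (Or (And (off a) (Var X)) (RegDia (Acts (el a - \<alpha>\<^sub>f)) (Var X))))))))))
    \<longleftrightarrow>
    \<not> (\<exists>\<pi>. is_path M \<pi> \<and> first \<pi> = initial M \<and>
         progressing M B \<pi> \<and> P M \<pi> \<and> violating \<rho> \<alpha>\<^sub>f \<alpha>\<^sub>e \<pi>)"
proof -
  interpret realised M B "P M" "\<lambda>a. closed_sem M (on a)" "\<lambda>a. closed_sem M (off a)" el
    using realised_closed_sem assms(1,6,7) by blast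
  let ?\<psi> = "\<lambda>a. Or (RegDia (Acts \<alpha>\<^sub>e) TT)
                 (Or (And (off a) (Var X)) (RegDia (Acts (el a - \<alpha>\<^sub>f)) (Var X)))"
  let ?\<Phi> = "BigAnd (acts M - B)
    (\<lambda>a. Imp (on a) (RegDia (Star (Acts (acts M - \<alpha>\<^sub>f))) (?\<psi> a)))"
  have fin: "finite (acts M)" using lts by (simp add: is_lts_def)
  \<comment> \<open>Closedness makes \<open>on\<close> and \<open>off\<close> independent of the
    environment, which changes with the value of \<open>X\<close>.\<close>
  have closed: "sem M (on a) e = closed_sem M (on a)" "sem M (off a) e = closed_sem M (off a)"
    if "a \<in> acts M - B" for a e
    using assms(7) that by (auto simp: finitely_realised_by_def closed_form_def sem_closed)
  \<comment> \<open>The bound on \<open>T\<close> is what \<open>sem_RegDia\<close> demands of the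
    environment, and it matches the range of the fixpoint.\<close>
  have sem_body: "sem M ?\<Phi> ((\<lambda>_. {})(X := T)) = body \<alpha>\<^sub>f \<alpha>\<^sub>e T" if T: "T \<subseteq> states M" for T
  proof -
    define e where "e = (\<lambda>_::nat. {})(X := T)"
    have e: "e Y \<subseteq> states M" for Y using T by (simp add: e_def)
    have target: "sem M (?\<psi> a) e = target \<alpha>\<^sub>f \<alpha>\<^sub>e T a" if a: "a \<in> acts M - B" for a
    proof -
      have "el a \<subseteq> acts M" using assms(7) a by (auto simp: finitely_realised_by_def)
      then have "finite (el a - \<alpha>\<^sub>f)" "finite \<alpha>\<^sub>e"
        using assms(4) fin by (auto intro: rev_finite_subset)
      then have "sem M (RegDia (Acts \<alpha>\<^sub>e) TT) e = {t. \<exists>b\<in>\<alpha>\<^sub>e. \<exists>t'. (t, b, t') \<in> transitions M}"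
        "sem M (RegDia (Acts (el a - \<alpha>\<^sub>f)) (Var X)) e =
          {t. \<exists>b\<in>el a - \<alpha>\<^sub>f. \<exists>t'. (t, b, t') \<in> transitions M \<and> t' \<in> T}"
        using lts by (auto simp: sem_RegDia_Acts sem_TT e_def is_lts_def simp del: RegDia.simps)
      moreover have "sem M (And (off a) (Var X)) e = closed_sem M (off a) \<inter> T"
        using T closed[OF a] by (auto simp: sem_And e_def)
      ultimately show ?thesis by (simp add: target_def Un_assoc del: RegDia.simps)
    qed
    have "sem M (Imp (on a) (RegDia (Star (Acts (acts M - \<alpha>\<^sub>f))) (?\<psi> a))) e =
        (states M - closed_sem M (on a)) \<union>
        {s. \<exists>w. set w \<subseteq> acts M - \<alpha>\<^sub>f \<and> (\<exists>t\<in>target \<alpha>\<^sub>f \<alpha>\<^sub>e T a. reach M w s t)}"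
      if a: "a \<in> acts M - B" for a
    proof -
      have "reg_over (acts M) (Star (Acts (acts M - \<alpha>\<^sub>f)))" by simp
      from sem_RegDia[of M e, OF lts e this] show ?thesis
        unfolding Imp_def sem.simps(3,4) closed[OF a]
        by (simp add: target[OF a, unfolded sem.simps(4)] lang_Star_Acts del: RegDia.simps lang.simps)
    qed
    then show ?thesis
      unfolding e_def[symmetric] sem_BigAnd[OF finite_Diff[OF fin]]
      by (auto simp: body_def)
  qed
  have "sem M (Nu X ?\<Phi>) (\<lambda>_. {}) = good \<alpha>\<^sub>f \<alpha>\<^sub>e"
  proof -
    have "T \<subseteq> states M \<and> T \<subseteq> sem M ?\<Phi> ((\<lambda>_. {})(X := T)) \<longleftrightarrow>
        T \<subseteq> states M \<and> T \<subseteq> body \<alpha>\<^sub>f \<alpha>\<^sub>e T" for T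
      by (rule conj_cong[OF refl]) (simp only: sem_body)
    then show ?thesis by (simp only: sem.simps(7) good_eq_gfp[symmetric])
  qed
  then have "closed_sem M (RegDia \<rho> (Nu X ?\<Phi>)) =
      {s. \<exists>w\<in>lang \<rho>. \<exists>t\<in>good \<alpha>\<^sub>f \<alpha>\<^sub>e. reach M w s t}"
    unfolding closed_sem_def using sem_RegDia[OF lts _ assms(5)] by simp
  \<comment> \<open>\<open>Neg\<close> is the complement within \<open>states M\<close>, so
    membership in it includes this fact.\<close>
  moreover have "initial M \<in> states M" using lts by (simp add: is_lts_def)
  ultimately show ?thesis
    unfolding violating_path_iff satisfies_def closed_sem_def sem.simps(3) by simp
qed

end
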